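(* Let $q$ be a prime power and let $V$ be an $n$-dimensional vector space over $\mathbb{F}_q$. Let $n,r,k_1,k_2,\ldots,k_r$ and $t$ be positive integers with $r\geq 2$, $k_1\geq k_2\geq\cdots\geq k_r\geq t$ and $n\geq k_1+k_2+t+1$. If $\mathcal{F}_1\subseteq {V\brack k_1},\ \mathcal{F}_2\subseteq {V\brack k_2},\ldots,\ \mathcal{F}_r\subseteq {V\brack k_r}$ are $r$-cross $t$-intersecting families, then $$\prod_{i=1}^r|\mathcal{F}_i|\leq \prod_{i=1}^r{n-t\brack k_i-t}.$$ Equality holds only if there is $T\in {V\brack t}$ such that $\mathcal{F}_i=\left\{F\in {V\brack k_i}\mid T\subseteq F\right\}$ for every $i=1,2,\ldots,r$.
   Context: For an integer $k$, ${V\brack k}$ denotes the set of all $k$-dimensional subspaces of $V$. The Gaussian binomial coefficient is ${a\brack b}=\prod_{0\leq i<b}\frac{q^{a-i}-1}{q^{b-i}-1}$ for positive integers $a,b$, with ${a\brack 0}=1$ and ${a\brack c}=0$ for negative $c$. Families $\mathcal{F}_1\subseteq{V\brack k_1},\ldots,\mathcal{F}_r\subseteq{V\brack k_r}$ are $r$-cross $t$-intersecting if $\dim(F_1\cap F_2\cap\cdots\cap F_r)\geq t$ for all $F_i\in\mathcal{F}_i$, $1\leq i\leq r$. *)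

theory Defs
  imports Complex_Main "HOL-Library.Cardinality"
begin

text \<open>
  The ambient space $V$ is the whole type \<open>'b\<close>, made a vector space over the field \<open>'a\<close> by
  \<open>scale\<close>. The library's \<open>dim\<close> is \<open>0\<close> on infinite-dimensional spaces, so the following set has
  its intended meaning at \<open>k = 0\<close> only if \<open>V\<close> is finite-dimensional.
\<close>

definition k_subspaces :: "('a::field \<Rightarrow> 'b::ab_group_add \<Rightarrow> 'b) \<Rightarrow> nat \<Rightarrow> 'b set set" where
  "k_subspaces scale k =
     {W. module.subspace scale W \<and> vector_space.dim scale W = k}"

text \<open>
  The lower index may be negative. For \<open>b = 0\<close> the product is empty, and for \<open>0 \<le> a < b\<close>
  the factor \<open>i = a\<close> vanishes.
\<close>

definition gaussian_binomial :: "nat \<Rightarrow> int \<Rightarrow> int \<Rightarrow> real" where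
  "gaussian_binomial q a b =
     (if b < 0 then 0
      else (\<Prod>i\<in>{0..<b}. (real q powi (a - i) - 1) / (real q powi (b - i) - 1)))"

definition cross_intersecting ::
    "('a::field \<Rightarrow> 'b::ab_group_add \<Rightarrow> 'b) \<Rightarrow> nat \<Rightarrow> nat \<Rightarrow> (nat \<Rightarrow> 'b set set) \<Rightarrow> bool" where
  "cross_intersecting scale r t \<F> \<longleftrightarrow>
     (\<forall>F. (\<forall>i\<in>{1..r}. F i \<in> \<F> i) \<longrightarrow> t \<le> vector_space.dim scale (\<Inter>i\<in>{1..r}. F i))"

end

(*
  For two families X, Y let s and s' be the least dimensions of subspaces meeting every member of Y,
  resp. X, in dimension at least t. A subspace H of dimension less than s has dim (H \<inter> G) < t for
  some G in Y, so the members of X containing H are distributed over at most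
  c = (q^(l-t+1) - 1) / (q - 1) subspaces of dimension dim H + 1; iterating from the t-subspaces of a
  minimal cover of X yields card X <= [s', t] c^(s-t) [n-s, k-s]. Exchanging the factors [s', t] and
  [s, t] between the bounds for X and Y separates the product into a function of s and one of s',
  and each of them is strictly decreasing from the value it takes at t.
  For r > 2 apply this to all pairs of families: positive numbers whose pairwise products are
  at most 1 have product at most 1.
*)

theory Submission
  imports Defs
begin

section \<open>Gaussian binomials with natural-number indices\<close>

text \<open>A form of \<open>gaussian_binomial\<close> with a real base and natural-number indices,
  suited to induction; \<open>gaussian_binomial_eq_gauss\<close> translates back.\<close>

definition gauss :: "real \<Rightarrow> nat \<Rightarrow> nat \<Rightarrow> real" where
  "gauss Q a b = (\<Prod>i<b. (Q ^ (a - i) - 1) / (Q ^ (b - i) - 1))"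

lemma gauss_0 [simp]: "gauss Q a 0 = 1"
  by (simp add: gauss_def)

lemma gauss_Suc_Suc:
  "gauss Q (Suc a) (Suc b) = (Q ^ Suc a - 1) / (Q ^ Suc b - 1) * gauss Q a b"
  unfolding gauss_def prod.lessThan_Suc_shift by simp

lemma gauss_pos:
  assumes "Q > 1" "b \<le> a"
  shows "gauss Q a b > 0"
  unfolding gauss_def
  by (rule prod_pos) (use assms in \<open>auto intro!: divide_pos_pos one_less_power\<close>)

lemma gauss_self [simp]:
  assumes "Q > 1"
  shows "gauss Q a a = 1"
proof (induction a)
  case (Suc a)
  have "Q ^ Suc a > 1" using assms by (rule one_less_power) simp
  then show ?case by (simp only: gauss_Suc_Suc Suc) simp
qed simp

text \<open>Lowering both indices by \<open>gauss_Suc_Suc\<close> leaves the exponent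
  \<open>Suc a - b\<close> unchanged, so induction on \<open>b\<close> works. The lemma provides the
  quotient of consecutive factors \<open>gauss Q s t\<close> in \<open>cover_bound\<close>.\<close>

lemma gauss_Suc_left:
  assumes "Q > 1" "b \<le> a"
  shows "gauss Q (Suc a) b * (Q ^ (Suc a - b) - 1) = (Q ^ Suc a - 1) * gauss Q a b"
  using assms(2)
proof (induction b arbitrary: a)
  case (Suc b)
  then obtain a' where a: "a = Suc a'" "b \<le> a'" by (cases a) auto
  have "gauss Q (Suc a) (Suc b) * (Q ^ (Suc a - Suc b) - 1)
      = (Q ^ Suc a - 1) / (Q ^ Suc b - 1) * (gauss Q (Suc a') b * (Q ^ (Suc a' - b) - 1))"
    by (simp only: gauss_Suc_Suc a) simp
  also have "\<dots> = (Q ^ Suc a - 1) * gauss Q a (Suc b)"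
    unfolding Suc.IH[OF a(2)] by (simp only: gauss_Suc_Suc a) simp
  finally show ?case .
qed simp

lemma gaussian_binomial_eq_gauss:
  assumes "b \<le> a"
  shows "gaussian_binomial q (int a) (int b) = gauss (real q) a b"
proof -
  have "(\<Prod>i\<in>{0..<int b}. (real q powi (int a - i) - 1) / (real q powi (int b - i) - 1))
      = (\<Prod>i<b. (real q powi (int a - int i) - 1) / (real q powi (int b - int i) - 1))"
    by (rule prod.reindex_bij_witness[where i = int and j = nat]) auto
  also have "\<dots> = gauss (real q) a b"
    unfolding gauss_def
    by (rule prod.cong) (use assms in \<open>auto simp: power_int_def nat_diff_distrib\<close>)
  finally show ?thesis by (simp add: gaussian_binomial_def)
qed

section \<open>Strict decrease of the bounds in the dimension of a minimal cover\<close>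

text \<open>The hypothesis on \<open>n\<close> is what makes this work: the three quotients are less than
  \<open>Q ^ (t + 1) / (Q - 1)\<close>, less than \<open>Q ^ (l - t + 1) / (Q - 1)\<close> and at least \<open>Q ^ (n - k)\<close>.\<close>

lemma cover_ratio_less:
  fixes Q :: real
  assumes Q: "Q \<ge> 2" and t: "1 \<le> t" "t \<le> s" "s < k" "t \<le> l" and n: "n \<ge> k + l + t + 1"
  shows "(Q ^ Suc s - 1) / (Q ^ (Suc s - t) - 1) * ((Q ^ (l - t + 1) - 1) / (Q - 1))
       < (Q ^ (n - s) - 1) / (Q ^ (k - s) - 1)"
proof -
  obtain m where m: "s = t + m" using t le_Suc_ex by blast
  have m1: "Q ^ (m + 1) > 1" by (rule one_less_power) (use Q in auto)
  have "Q ^ (t + 1) \<le> Q ^ (t + m + 1)"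
    by (rule power_increasing) (use Q in auto)
  \<comment> \<open>The right side is positive, which is the bound on the first quotient with
    denominators cleared.\<close>
  moreover have "Q ^ (t + 1) * (Q ^ (m + 1) - 1) - (Q - 1) * (Q ^ (t + m + 1) - 1)
      = (Q ^ (t + m + 1) - Q ^ (t + 1)) + (Q - 1)"
    by (simp add: algebra_simps power_add)
  ultimately have "(Q - 1) * (Q ^ (t + m + 1) - 1) < Q ^ (t + 1) * (Q ^ (m + 1) - 1)"
    using Q by linarith
  then have "(Q ^ (t + m + 1) - 1) / (Q ^ (m + 1) - 1) < Q ^ (t + 1) / (Q - 1)"
    using Q m1 by (simp add: field_simps)
  then have A: "(Q ^ Suc s - 1) / (Q ^ (Suc s - t) - 1) < Q ^ (t + 1) / (Q - 1)"
    by (simp add: m Suc_diff_le)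
  have C: "(Q ^ (l - t + 1) - 1) / (Q - 1) < Q ^ (l - t + 1) / (Q - 1)"
    using Q by (simp add: divide_strict_right_mono)
  have C0: "0 \<le> (Q ^ (l - t + 1) - 1) / (Q - 1)"
    using Q by (intro divide_nonneg_nonneg) (auto intro: one_le_power simp del: power_Suc)
  have "(Q ^ Suc s - 1) / (Q ^ (Suc s - t) - 1) * ((Q ^ (l - t + 1) - 1) / (Q - 1))
      \<le> Q ^ (t + 1) / (Q - 1) * ((Q ^ (l - t + 1) - 1) / (Q - 1))"
    by (rule mult_right_mono) (use A C0 in auto)
  also have "\<dots> < Q ^ (t + 1) / (Q - 1) * (Q ^ (l - t + 1) / (Q - 1))"
    by (rule mult_strict_left_mono[OF C]) (use Q in auto)
  also have "\<dots> = Q ^ (l + 2) / ((Q - 1) * (Q - 1))"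
    using t by (simp flip: power_add)
  \<comment> \<open>\<open>Q \<ge> 2\<close> is used in full here, through
    \<open>(Q - 1) * (Q - 1) \<ge> 1\<close>.\<close>
  also have "\<dots> \<le> Q ^ (l + 2)"
  proof -
    have "1 \<le> (Q - 1) * (Q - 1)" using mult_mono[of 1 "Q - 1" 1 "Q - 1"] Q by simp
    then show ?thesis using Q by (simp add: divide_le_eq)
  qed
  \<comment> \<open>The exponents \<open>t + 1\<close> and \<open>l - t + 1\<close> have added up to
    \<open>l + 2\<close>, and \<open>n \<ge> k + l + t + 1\<close> with \<open>t \<ge> 1\<close>
    gives \<open>l + 2 \<le> n - k\<close>.\<close>
  also have "\<dots> \<le> Q ^ (n - k)"
    by (rule power_increasing) (use Q n t in auto)
  also have "\<dots> \<le> (Q ^ (n - s) - 1) / (Q ^ (k - s) - 1)"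
  proof -
    have p: "Q ^ (k - s) > 1" by (rule one_less_power) (use Q t in auto)
    have e: "n - s = (n - k) + (k - s)" using n t by simp
    have "1 \<le> Q ^ (n - k)" by (rule one_le_power) (use Q in auto)
    then have "Q ^ (n - k) * (Q ^ (k - s) - 1) \<le> Q ^ (n - s) - 1"
      by (simp add: e power_add algebra_simps)
    then show ?thesis using p by (simp add: le_divide_eq)
  qed
  finally show ?thesis .
qed

text \<open>In the product of the bounds for the two families, \<open>gauss Q s t\<close> comes from the bound for the
  other family.\<close>

definition cover_bound :: "real \<Rightarrow> nat \<Rightarrow> nat \<Rightarrow> nat \<Rightarrow> nat \<Rightarrow> nat \<Rightarrow> real" where
  "cover_bound Q n t k l s =
     gauss Q s t * ((Q ^ (l - t + 1) - 1) / (Q - 1)) ^ (s - t) * gauss Q (n - s) (k - s)"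

lemma cover_bound_pos:
  assumes "Q > 1" "t \<le> s" "s \<le> k" "k \<le> n"
  shows "cover_bound Q n t k l s > 0"
proof -
  have "Q ^ (l - t + 1) > 1" by (rule one_less_power) (use assms in auto)
  then show ?thesis
    unfolding cover_bound_def using assms
    by (intro mult_pos_pos gauss_pos zero_less_power divide_pos_pos) auto
qed

text \<open>Passing from \<open>s\<close> to \<open>Suc s\<close> multiplies
  \<open>gauss Q s t\<close> by \<open>A\<close> and the power by \<open>c\<close>, and divides the
  last factor by \<open>B\<close>; so the claim is \<open>cover_ratio_less\<close> times the common
  positive factor \<open>R\<close>.\<close>

lemma cover_bound_Suc_less:
  assumes Q: "Q \<ge> 2" and t: "1 \<le> t" "t \<le> s" "s < k" "t \<le> l" and n: "n \<ge> k + l + t + 1"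
  shows "cover_bound Q n t k l (Suc s) < cover_bound Q n t k l s"
proof -
  define A where "A = (Q ^ Suc s - 1) / (Q ^ (Suc s - t) - 1)"
  define B where "B = (Q ^ (n - s) - 1) / (Q ^ (k - s) - 1)"
  define c where "c = (Q ^ (l - t + 1) - 1) / (Q - 1)"
  have less: "A * c < B"
    unfolding A_def B_def c_def using assms by (rule cover_ratio_less)
  have "Q ^ (l - t + 1) > 1" by (rule one_less_power) (use Q in auto)
  then have c: "c > 0" unfolding c_def using Q by simp
  have "Q ^ (Suc s - t) > 1" by (rule one_less_power) (use Q t in auto)
  then have "Q ^ (Suc s - t) - 1 \<noteq> 0" by simp
  then have gA: "gauss Q (Suc s) t = A * gauss Q s t"
    using gauss_Suc_left[of Q t s] Q t by (simp add: A_def eq_divide_eq del: power_Suc)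
  have "n - s = Suc (n - Suc s)" "k - s = Suc (k - Suc s)" using t n by auto
  then have gB: "gauss Q (n - s) (k - s) = B * gauss Q (n - Suc s) (k - Suc s)"
    unfolding B_def using gauss_Suc_Suc by metis
  define R where "R = gauss Q s t * c ^ (s - t) * gauss Q (n - Suc s) (k - Suc s)"
  have "R > 0"
    unfolding R_def using Q t n c by (intro mult_pos_pos gauss_pos zero_less_power) auto
  have "cover_bound Q n t k l (Suc s) = A * c * R"
    using t by (simp add: cover_bound_def gA R_def Suc_diff_le c_def)
  moreover have "cover_bound Q n t k l s = B * R"
    using t by (simp add: cover_bound_def gB R_def c_def)
  ultimately show ?thesis using less \<open>R > 0\<close> by simp
qed

lemma cover_bound_self:
  assumes "Q > 1"
  shows "cover_bound Q n t k l t = gauss Q (n - t) (k - t)"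
  using assms by (simp add: cover_bound_def)

lemma cover_bound_less:
  assumes Q: "Q \<ge> 2" and t: "1 \<le> t" "t < s" "s \<le> k" "t \<le> l" and n: "n \<ge> k + l + t + 1"
  shows "cover_bound Q n t k l s < gauss Q (n - t) (k - t)"
proof -
  have "Suc t \<le> s" using t by simp
  then have "s \<le> k \<longrightarrow> cover_bound Q n t k l s < cover_bound Q n t k l t"
  proof (induction s rule: dec_induct)
    case base
    show ?case using cover_bound_Suc_less[OF Q t(1) order_refl _ t(4) n] by simp
  next
    case (step m)
    show ?case using cover_bound_Suc_less[OF Q t(1) _ _ t(4) n, of m] step by fastforce
  qed
  then show ?thesis using t Q by (simp add: cover_bound_self)
qed

lemma cover_bound_le:
  assumes Q: "Q \<ge> 2" and t: "1 \<le> t" "t \<le> s" "s \<le> k" "t \<le> l" and n: "n \<ge> k + l + t + 1"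
  shows "cover_bound Q n t k l s \<le> gauss Q (n - t) (k - t)"
  using cover_bound_less[OF Q t(1) _ t(3,4) n] cover_bound_self[of Q n t k l] Q t
  by (cases "s = t") auto

section \<open>Counting vectors and subspaces over a finite field\<close>

text \<open>Both sides estimate the number of pairs \<open>(v, F)\<close> with \<open>R v F\<close>:
  every \<open>F\<close> lies in at least \<open>d\<close> of them, every \<open>v\<close> in at
  most \<open>M\<close>.\<close>

lemma double_count_le:
  fixes M :: real
  assumes "finite X" "finite A"
    and "\<And>F. F \<in> X \<Longrightarrow> d \<le> card {v \<in> A. R v F}"
    and "\<And>v. v \<in> A \<Longrightarrow> real (card {F \<in> X. R v F}) \<le> M"
  shows "real d * real (card X) \<le> real (card A) * M"
proof -
  have "real d * real (card X) = (\<Sum>F\<in>X. real d)" by simp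
  also have "\<dots> \<le> (\<Sum>F\<in>X. real (card {v \<in> A. R v F}))"
    by (rule sum_mono) (use assms in auto)
  also have "\<dots> = (\<Sum>v\<in>A. real (card {F \<in> X. R v F}))"
    using sum_multicount_gen[OF assms(2,1), of R "\<lambda>F. card {v \<in> A. R v F}"]
    by (simp flip: of_nat_sum)
  also have "\<dots> \<le> (\<Sum>v\<in>A. M)" by (rule sum_mono) (use assms in auto)
  finally show ?thesis by simp
qed

lemma card_field_ge_2: "CARD('a::{field,finite}) \<ge> 2"
proof -
  have "card {0, 1::'a} \<le> CARD('a)" by (rule card_mono) auto
  then show ?thesis by simp
qed

text \<open>\<open>q\<close> is the field size as a real number, the base for \<open>gauss\<close>;
  cardinalities themselves are powers of the natural number \<open>CARD('a)\<close>.\<close>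

locale finite_field_vector_space = finite_dimensional_vector_space scale Basis
  for scale :: "'a::{field,finite} \<Rightarrow> 'b::ab_group_add \<Rightarrow> 'b" (infixr \<open>*s\<close> 75)
    and Basis :: "'b set" +
  fixes q :: real
  assumes q_eq: "q = real CARD('a)"
begin

lemma q_ge_2: "q \<ge> 2" and q_gt_1: "q > 1"
  using card_field_ge_2[where 'a = 'a] by (auto simp: q_eq)

text \<open>The map \<open>(c, x) \<mapsto> c *s v + x\<close> is a bijection from pairs of a scalar
  and a vector of \<open>span S\<close>: two representations with different scalars would put
  \<open>v\<close> into \<open>span S\<close>.\<close>

lemma card_span_insert:
  assumes "v \<notin> span S"
  shows "card (span (insert v S)) = CARD('a) * card (span S)"
proof -
  have eq: "span (insert v S) = (\<lambda>(c, x). c *s v + x) ` (UNIV \<times> span S)"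
  proof
    show "span (insert v S) \<subseteq> (\<lambda>(c, x). c *s v + x) ` (UNIV \<times> span S)"
      by (force simp: span_insert)
    show "(\<lambda>(c, x). c *s v + x) ` (UNIV \<times> span S) \<subseteq> span (insert v S)"
      by (auto simp: span_insert) (metis add_diff_cancel_left')
  qed
  have "inj_on (\<lambda>(c, x). c *s v + x) (UNIV \<times> span S)"
  proof (rule inj_onI, clarsimp)
    fix a b x y
    assume xy: "x \<in> span S" "y \<in> span S" and e: "a *s v + x = b *s v + y"
    have "(a - b) *s v = y - x" using e by (simp add: scale_left_diff_distrib algebra_simps)
    then have mem: "(a - b) *s v \<in> span S" using xy span_diff by metis
    have "a = b"
    proof (rule ccontr)
      assume "a \<noteq> b"
      then have "v = inverse (a - b) *s ((a - b) *s v)" by simp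
      then show False using assms span_scale[OF mem] by metis
    qed
    then show "a = b \<and> x = y" using e by simp
  qed
  then show ?thesis by (simp add: eq card_image card_cartesian_product)
qed

lemma card_span_independent:
  assumes "finite B" "independent B"
  shows "card (span B) = CARD('a) ^ card B"
  using assms
proof (induction B)
  case (insert v B)
  then have "v \<notin> span B" "independent B" by (simp_all add: independent_insert)
  with insert show ?case by (simp add: card_span_insert)
qed simp

lemma card_subspace:
  assumes "subspace S"
  shows "card S = CARD('a) ^ dim S"
proof -
  obtain B where "finite B" "independent B" "span B = S" "card B = dim S"
    using basis_subspace_exists[OF assms] by metis
  then show ?thesis using card_span_independent by metis
qed

lemma finite_UNIV_space: "finite (UNIV :: 'b set)"
proof -
  have "card (UNIV :: 'b set) = CARD('a) ^ dim (UNIV :: 'b set)"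
    by (rule card_subspace) (simp add: subspace_def)
  \<comment> \<open>Infinite sets have cardinality 0, so a positive cardinality proves
    finiteness.\<close>
  then show ?thesis by (intro card_ge_0_finite) simp
qed

lemma finite_vectors: "finite (S :: 'b set)"
  using finite_UNIV_space finite_subset subset_UNIV by metis

lemma finite_families: "finite (X :: 'b set set)"
  using finite_UNIV_space by (meson Finite_Set.finite_set finite_subset subset_UNIV)

text \<open>\<open>W\<close> grows by one vector at a time, taken from \<open>S\<close> outside the
  sum \<open>U\<close> of \<open>H \<inter> S\<close> and the current \<open>W\<close>. The
  dimension hypothesis keeps \<open>U\<close> from filling \<open>S\<close>.\<close>

lemma exists_complement_of_dim:
  assumes S: "subspace S" and H: "subspace H" and m: "m + dim (H \<inter> S) \<le> dim S"
  obtains W where "subspace W" "W \<subseteq> S" "W \<inter> H = {0}" "dim W = m"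
proof -
  have "\<exists>W. subspace W \<and> W \<subseteq> S \<and> W \<inter> H = {0} \<and> dim W = m" using m
  proof (induction m)
    case 0
    have "subspace {0}" "{0} \<subseteq> S" "{0} \<inter> H = {0}" "dim {0} = 0"
      using S H subspace_0 by auto
    then show ?case by blast
  next
    case (Suc m)
    then obtain W where W: "subspace W" "W \<subseteq> S" "W \<inter> H = {0}" "dim W = m" by auto
    define U where "U = {x + y |x y. x \<in> H \<inter> S \<and> y \<in> W}"
    have sHS: "subspace (H \<inter> S)" using S H subspace_inter by blast
    have U: "subspace U" unfolding U_def using sHS W by (intro subspace_sums)
    have "H \<inter> S \<inter> W = {0}" using W(2,3) by auto
    then have "dim U = dim (H \<inter> S) + m"
      using dim_sums_Int[OF sHS W(1)] W(4) unfolding U_def by simp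
    then have "\<not> S \<subseteq> U" using Suc.prems dim_subset[of S U] by auto
    then obtain v where v: "v \<in> S" "v \<notin> U" by auto
    have WU: "W \<subseteq> U" and HU: "H \<inter> S \<subseteq> U"
      unfolding U_def using subspace_0[OF sHS] subspace_0[OF W(1)] by force+
    define W' where "W' = span (insert v W)"
    have vW: "v \<notin> span W" using v WU W(1) by (metis span_eq_iff subsetD)
    have W'S: "W' \<subseteq> S" unfolding W'_def using v W S by (intro span_minimal) auto
    \<comment> \<open>Modulo \<open>W\<close>, \<open>x\<close> is a multiple \<open>a *s v\<close>.
      As \<open>x\<close> lies in \<open>H \<inter> S \<subseteq> U\<close>, so does
      \<open>a *s v\<close>; this forces \<open>a = 0\<close> and puts \<open>x\<close> into
      \<open>W \<inter> H\<close>.\<close>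
    have "x = 0" if x: "x \<in> W'" "x \<in> H" for x
    proof -
      obtain a where a: "x - a *s v \<in> W"
        using x(1) W(1) unfolding W'_def span_insert by (auto simp: span_eq_iff[THEN iffD2])
      have "x \<in> U" using x W'S HU by auto
      then have "a *s v \<in> U" using a WU U
        by (metis diff_diff_eq2 add_diff_cancel_left' subsetD subspace_diff)
      then have "a = 0"
        using v(2) U by (metis scale_scale subspace_scale left_inverse scale_one)
      then show "x = 0" using a x W(3) by auto
    qed
    moreover have "0 \<in> W' \<inter> H" using H subspace_0 by (simp add: W'_def span_zero)
    ultimately have "W' \<inter> H = {0}" by blast
    moreover have "subspace W'" by (simp add: W'_def)
    moreover have "dim W' = Suc m" using vW W(4) by (simp add: W'_def dim_insert)
    ultimately show ?case using W'S by blast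
  qed
  then show ?thesis using that by blast
qed

text \<open>Downward induction on \<open>h\<close>, double counting pairs \<open>v \<in> F\<close>
  with \<open>v \<in> U - H\<close>: each \<open>F\<close> has \<open>q ^ k - q ^ h\<close> vectors
  outside \<open>H\<close>, and the \<open>F\<close> through \<open>v\<close> contain
  \<open>span (insert v H)\<close>, of dimension \<open>Suc h\<close>.\<close>

lemma card_subspaces_between_le:
  assumes U: "subspace U" "dim U = d" and H: "subspace H" "dim H = h" "H \<subseteq> U"
    and le: "h \<le> k" "k \<le> d"
  shows "real (card {F \<in> k_subspaces scale k. H \<subseteq> F \<and> F \<subseteq> U}) \<le> gauss q (d - h) (k - h)"
  using le(1) H
proof (induction h arbitrary: H rule: inc_induct)
  case base
  have "{F \<in> k_subspaces scale k. H \<subseteq> F \<and> F \<subseteq> U} \<subseteq> {H}"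
    using subspace_dim_equal[OF base(1)] base(2) unfolding k_subspaces_def by fastforce
  then have "card {F \<in> k_subspaces scale k. H \<subseteq> F \<and> F \<subseteq> U} \<le> card {H}"
    by (intro card_mono) auto
  then show ?case by simp
next
  case (step h)
  let ?X = "{F \<in> k_subspaces scale k. H \<subseteq> F \<and> F \<subseteq> U}"
  have cH: "card H = CARD('a) ^ h" using card_subspace step.prems by metis
  have "real (CARD('a) ^ k - CARD('a) ^ h) * real (card ?X)
      \<le> real (card (U - H)) * gauss q (d - Suc h) (k - Suc h)"
  proof (rule double_count_le[where R = "\<lambda>v F. v \<in> F"])
    fix F assume F: "F \<in> ?X"
    then have "{v \<in> U - H. v \<in> F} = F - H" by auto
    moreover have "card (F - H) = card F - card H"
      using F by (intro card_Diff_subset finite_vectors) auto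
    moreover have "card F = CARD('a) ^ k"
      using F card_subspace unfolding k_subspaces_def by auto
    ultimately show "CARD('a) ^ k - CARD('a) ^ h \<le> card {v \<in> U - H. v \<in> F}" using cH by simp
  next
    fix v assume v: "v \<in> U - H"
    have "{F \<in> ?X. v \<in> F} = {F \<in> k_subspaces scale k. span (insert v H) \<subseteq> F \<and> F \<subseteq> U}"
      unfolding k_subspaces_def
      by (auto simp: span_minimal intro: span_base dest: subsetD[OF span_minimal, rotated 2])
    moreover have "dim (span (insert v H)) = Suc h"
      using v step.prems by (simp add: dim_insert span_eq_iff[THEN iffD2])
    moreover have "span (insert v H) \<subseteq> U" using v step.prems U by (intro span_minimal) auto
    ultimately show "real (card {F \<in> ?X. v \<in> F}) \<le> gauss q (d - Suc h) (k - Suc h)"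
      using step.IH[of "span (insert v H)"] by simp
  qed (rule finite_families finite_vectors)+
  moreover have "card (U - H) = CARD('a) ^ d - CARD('a) ^ h"
    using card_Diff_subset[OF finite_vectors step.prems(3)] card_subspace U cH by metis
  \<comment> \<open>After the common factor \<open>q ^ h\<close> is cancelled, the two counts leave
    the quotient of \<open>gauss_Suc_Suc\<close>.\<close>
  moreover have "real (CARD('a) ^ m - CARD('a) ^ h) = q ^ h * (q ^ (m - h) - 1)" if "h \<le> m" for m
  proof -
    have "CARD('a) ^ h \<le> CARD('a) ^ m"
      by (rule power_increasing) (use that card_field_ge_2[where 'a = 'a] in auto)
    then show ?thesis using that by (simp add: of_nat_diff right_diff_distrib flip: power_add q_eq)
  qed
  ultimately have "q ^ h * (q ^ (k - h) - 1) * real (card ?X)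
      \<le> q ^ h * (q ^ (d - h) - 1) * gauss q (d - Suc h) (k - Suc h)"
    using step.hyps le by simp
  then have "(q ^ (k - h) - 1) * real (card ?X)
      \<le> (q ^ (d - h) - 1) * gauss q (d - Suc h) (k - Suc h)"
    using q_gt_1 by (simp add: mult.assoc)
  moreover have "q ^ (k - h) > 1" by (rule one_less_power) (use q_gt_1 step.hyps in auto)
  ultimately have "real (card ?X)
      \<le> (q ^ (d - h) - 1) / (q ^ (k - h) - 1) * gauss q (d - Suc h) (k - Suc h)"
    by (simp add: field_simps)
  also have "\<dots> = gauss q (d - h) (k - h)"
    using gauss_Suc_Suc[of q "d - Suc h" "k - Suc h"] step.hyps le
    by (simp add: Suc_diff_Suc)
  finally show ?case .
qed

lemma card_star_le:
  assumes "subspace H" "dim H \<le> k" "k \<le> dim (UNIV :: 'b set)"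
  shows "real (card {F \<in> k_subspaces scale k. H \<subseteq> F}) \<le> gauss q (dim (UNIV :: 'b set) - dim H) (k - dim H)"
  using card_subspaces_between_le[of UNIV _ H _ k] assms by (auto simp: subspace_def)

section \<open>Bounding one family by covers of both\<close>

text \<open>A subspace \<open>W\<close> of \<open>G\<close> of codimension \<open>t - 1\<close> meets every \<open>F\<close> with \<open>dim (F \<inter> G) \<ge> t\<close>;
  as \<open>dim (H \<inter> G) < t\<close>, it can be chosen to meet \<open>H\<close> trivially.\<close>

lemma card_containing_step:
  assumes X: "\<And>F. F \<in> \<X> \<Longrightarrow> subspace F \<and> t \<le> dim (F \<inter> G)"
    and G: "subspace G" "dim G = l" and H: "subspace H" "dim (H \<inter> G) < t" and t: "t \<le> l"
    and M: "\<And>H'. subspace H' \<Longrightarrow> dim H' = Suc (dim H) \<Longrightarrow> H \<subseteq> H'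
              \<Longrightarrow> real (card {F \<in> \<X>. H' \<subseteq> F}) \<le> M"
  shows "real (card {F \<in> \<X>. H \<subseteq> F}) \<le> (q ^ (l - t + 1) - 1) / (q - 1) * M"
proof -
  have "(l - t + 1) + dim (H \<inter> G) \<le> dim G" using G H t by linarith
  then obtain W where W: "subspace W" "W \<subseteq> G" "W \<inter> H = {0}" "dim W = l - t + 1"
    using exists_complement_of_dim[OF G(1) H(1)] by metis
  let ?X = "{F \<in> \<X>. H \<subseteq> F}"
  have W0: "0 \<in> W" using W(1) by (rule subspace_0)
  \<comment> \<open>Nonzero vectors \<open>v\<close> of \<open>W\<close> are counted against the
    members \<open>F\<close> above \<open>H\<close>; those through \<open>v\<close> lie above a
    subspace of dimension \<open>Suc (dim H)\<close>.\<close>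
  have "real (CARD('a) - 1) * real (card ?X) \<le> real (card (W - {0})) * M"
  proof (rule double_count_le[where R = "\<lambda>v F. v \<in> F"])
    fix F assume "F \<in> ?X"
    then have F: "subspace F" "t \<le> dim (F \<inter> G)" using X by auto
    have FG: "subspace (F \<inter> G)" using F G subspace_inter by blast
    \<comment> \<open>Inside \<open>G\<close>, of dimension \<open>l\<close>, the dimensions
      \<open>t\<close> and \<open>l - t + 1\<close> overlap in at least 1, so \<open>F\<close>
      contains at least \<open>q - 1\<close> nonzero vectors of \<open>W\<close>.\<close>
    have "{x + y |x y. x \<in> F \<inter> G \<and> y \<in> W} \<subseteq> G"
      using W(2) G subspace_add by blast
    then have "dim {x + y |x y. x \<in> F \<inter> G \<and> y \<in> W} \<le> l"
      using dim_subset[of _ G] G(2) by simp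
    then have "dim (F \<inter> G \<inter> W) \<ge> 1"
      using dim_sums_Int[OF FG W(1)] F(2) W(4) t by simp
    moreover have FW: "subspace (F \<inter> G \<inter> W)" using FG W subspace_inter by blast
    ultimately have "CARD('a) ^ 1 \<le> card (F \<inter> G \<inter> W)"
      unfolding card_subspace[OF FW]
      by (intro power_increasing) (use card_field_ge_2[where 'a = 'a] in auto)
    moreover have "{v \<in> W - {0}. v \<in> F} = F \<inter> G \<inter> W - {0}" using W by auto
    moreover have "card (F \<inter> G \<inter> W - {0}) = card (F \<inter> G \<inter> W) - 1"
      using subspace_0[OF FW] finite_vectors by (simp add: card_Diff_singleton)
    ultimately show "CARD('a) - 1 \<le> card {v \<in> W - {0}. v \<in> F}" by simp
  next
    fix v assume v: "v \<in> W - {0}"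
    then have "v \<notin> H" using W by auto
    then have d: "dim (span (insert v H)) = Suc (dim H)"
      using H by (simp add: dim_insert span_eq_iff[THEN iffD2])
    have "{F \<in> ?X. v \<in> F} = {F \<in> \<X>. span (insert v H) \<subseteq> F}"
      using X by (auto intro: span_base dest: subsetD[OF span_minimal, rotated 2])
    then show "real (card {F \<in> ?X. v \<in> F}) \<le> M"
      using M[OF _ d] span_superset by (metis insert_subset subspace_span)
  qed (rule finite_families finite_vectors)+
  moreover have "card (W - {0}) = CARD('a) ^ (l - t + 1) - 1"
    using card_subspace[OF W(1)] W(4) W0 finite_vectors by (simp add: card_Diff_singleton)
  moreover have "1 \<le> CARD('a) ^ (l - t + 1)" "1 \<le> CARD('a)"
    using card_field_ge_2[where 'a = 'a] by (auto intro: one_le_power simp del: power_Suc)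
  ultimately have "(q - 1) * real (card ?X) \<le> (q ^ (l - t + 1) - 1) * M"
    by (simp add: of_nat_diff q_eq)
  then show ?thesis using q_gt_1 by (simp add: field_simps)
qed

text \<open>The induction runs down from \<open>h = s\<close>, where the star of \<open>H\<close>
  bounds the count. Below \<open>s\<close>, \<open>small\<close> yields the \<open>G\<close> for
  \<open>card_containing_step\<close>, at the cost of one more factor.\<close>

lemma card_containing_le:
  assumes X: "\<X> \<subseteq> k_subspaces scale k" and Y: "\<Y> \<subseteq> k_subspaces scale l"
    and cross: "\<And>F G. F \<in> \<X> \<Longrightarrow> G \<in> \<Y> \<Longrightarrow> t \<le> dim (F \<inter> G)"
    and small: "\<And>S. subspace S \<Longrightarrow> dim S < s \<Longrightarrow> \<exists>G\<in>\<Y>. dim (S \<inter> G) < t"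
    and H: "subspace H" "dim H = h" "h \<le> s"
    and le: "s \<le> k" "k \<le> dim (UNIV :: 'b set)" "t \<le> l"
  shows "real (card {F \<in> \<X>. H \<subseteq> F})
       \<le> ((q ^ (l - t + 1) - 1) / (q - 1)) ^ (s - h) * gauss q (dim (UNIV :: 'b set) - s) (k - s)"
  using H(3,1,2)
proof (induction h arbitrary: H rule: inc_induct)
  case base
  have "card {F \<in> \<X>. H \<subseteq> F} \<le> card {F \<in> k_subspaces scale k. H \<subseteq> F}"
    using X by (intro card_mono finite_families) auto
  then show ?case using card_star_le[of H k] base le by simp
next
  case (step h)
  let ?M = "((q ^ (l - t + 1) - 1) / (q - 1)) ^ (s - Suc h)
              * gauss q (dim (UNIV :: 'b set) - s) (k - s)"
  obtain G where G: "G \<in> \<Y>" "dim (H \<inter> G) < t" using small step by metis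
  have "real (card {F \<in> \<X>. H \<subseteq> F}) \<le> (q ^ (l - t + 1) - 1) / (q - 1) * ?M"
    by (rule card_containing_step[where G = G])
      (use G X Y cross step le in \<open>auto simp: k_subspaces_def\<close>)
  also have "\<dots> = ((q ^ (l - t + 1) - 1) / (q - 1)) ^ Suc (s - Suc h)
              * gauss q (dim (UNIV :: 'b set) - s) (k - s)"
    by (simp add: mult.assoc)
  also have "Suc (s - Suc h) = s - h" using step.hyps by simp
  finally show ?case .
qed

text \<open>Every \<open>F\<close> contains a \<open>t\<close>-subspace of
  \<open>S' \<inter> F\<close>. There are at most \<open>gauss q s' t\<close> such subspaces of
  \<open>S'\<close>, and \<open>card_containing_le\<close> with \<open>h = t\<close> bounds the
  members above each.\<close>

lemma card_le_cover_bound: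
  assumes X: "\<X> \<subseteq> k_subspaces scale k" and Y: "\<Y> \<subseteq> k_subspaces scale l"
    and cross: "\<And>F G. F \<in> \<X> \<Longrightarrow> G \<in> \<Y> \<Longrightarrow> t \<le> dim (F \<inter> G)"
    and small: "\<And>S. subspace S \<Longrightarrow> dim S < s \<Longrightarrow> \<exists>G\<in>\<Y>. dim (S \<inter> G) < t"
    and S': "subspace S'" "dim S' = s'" "\<And>F. F \<in> \<X> \<Longrightarrow> t \<le> dim (S' \<inter> F)"
    and le: "t \<le> s" "s \<le> k" "k \<le> dim (UNIV :: 'b set)" "t \<le> l" "t \<le> s'"
  shows "real (card \<X>) \<le> gauss q s' t *
     (((q ^ (l - t + 1) - 1) / (q - 1)) ^ (s - t) * gauss q (dim (UNIV :: 'b set) - s) (k - s))"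
    (is "_ \<le> _ * ?M")
proof -
  \<comment> \<open>The conjunct \<open>{0} \<subseteq> T\<close> gives the set the shape counted by
    \<open>card_subspaces_between_le\<close>.\<close>
  define \<T> where "\<T> = {T \<in> k_subspaces scale t. {0} \<subseteq> T \<and> T \<subseteq> S'}"
  have "\<X> \<subseteq> (\<Union>T\<in>\<T>. {F \<in> \<X>. T \<subseteq> F})"
  proof
    fix F assume F: "F \<in> \<X>"
    then have "subspace (S' \<inter> F)"
      using X S' subspace_inter unfolding k_subspaces_def by blast
    moreover obtain T where "subspace T" "T \<subseteq> span (S' \<inter> F)" "dim T = t"
      using choose_subspace_of_subspace[OF S'(3)[OF F]] by blast
    ultimately have "T \<in> \<T>" "T \<subseteq> F"
      using subspace_0[of T] unfolding \<T>_def k_subspaces_def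
      by (auto simp: span_eq_iff[THEN iffD2])
    then show "F \<in> (\<Union>T\<in>\<T>. {F \<in> \<X>. T \<subseteq> F})" using F by auto
  qed
  then have "card \<X> \<le> card (\<Union>T\<in>\<T>. {F \<in> \<X>. T \<subseteq> F})"
    by (intro card_mono finite_families)
  also have "\<dots> \<le> (\<Sum>T\<in>\<T>. card {F \<in> \<X>. T \<subseteq> F})"
    by (intro card_UN_le finite_families)
  finally have "real (card \<X>) \<le> (\<Sum>T\<in>\<T>. real (card {F \<in> \<X>. T \<subseteq> F}))"
    by (simp flip: of_nat_sum)
  also have "\<dots> \<le> (\<Sum>T\<in>\<T>. ?M)"
    by (rule sum_mono, rule card_containing_le[OF X Y cross small])
      (use le in \<open>auto simp: \<T>_def k_subspaces_def\<close>)
  also have "\<dots> = real (card \<T>) * ?M" by simp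
  also have "\<dots> \<le> gauss q s' t * ?M"
  proof (rule mult_right_mono)
    have "subspace {0}" by (simp add: subspace_def)
    then show "real (card \<T>) \<le> gauss q s' t"
      using card_subspaces_between_le[OF S'(1,2), of "{0}" 0 t] subspace_0[OF S'(1)] le
      by (simp add: \<T>_def)
    have "1 \<le> q ^ (l - t + 1)" by (rule one_le_power) (use q_gt_1 in auto)
    then show "0 \<le> ?M" using q_gt_1 le
      by (intro mult_nonneg_nonneg zero_le_power divide_nonneg_nonneg less_imp_le[OF gauss_pos]) auto
  qed
  finally show ?thesis .
qed

text \<open>Each member of \<open>\<X>\<close> is itself a cover, whence \<open>s \<le> k\<close>;
  meeting one member of \<open>\<Y>\<close> in dimension \<open>t\<close> gives
  \<open>t \<le> s\<close>.\<close>

lemma exists_min_cover: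
  assumes "F0 \<in> \<X>" "Y0 \<in> \<Y>" "\<X> \<subseteq> k_subspaces scale k"
    and cross: "\<And>F G. F \<in> \<X> \<Longrightarrow> G \<in> \<Y> \<Longrightarrow> t \<le> dim (F \<inter> G)"
  obtains s S where "t \<le> s" "s \<le> k" "subspace S" "dim S = s" "\<And>G. G \<in> \<Y> \<Longrightarrow> t \<le> dim (S \<inter> G)"
    "\<And>S'. subspace S' \<Longrightarrow> dim S' < s \<Longrightarrow> \<exists>G\<in>\<Y>. dim (S' \<inter> G) < t"
proof -
  let ?P = "\<lambda>s. \<exists>S. subspace S \<and> dim S = s \<and> (\<forall>G\<in>\<Y>. t \<le> dim (S \<inter> G))"
  define s where "s = (LEAST s. ?P s)"
  have Pk: "?P k" using assms unfolding k_subspaces_def by blast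
  then have "?P s" unfolding s_def by (rule LeastI)
  then obtain S where S: "subspace S" "dim S = s" "\<And>G. G \<in> \<Y> \<Longrightarrow> t \<le> dim (S \<inter> G)" by blast
  have "s \<le> k" unfolding s_def using Pk by (rule Least_le)
  moreover have "t \<le> s" using S assms(2) dim_subset[of "S \<inter> Y0" S] by fastforce
  moreover have "\<exists>G\<in>\<Y>. dim (S' \<inter> G) < t" if "subspace S'" "dim S' < s" for S'
    using not_less_Least[of "dim S'" ?P] that unfolding s_def by (auto simp: not_le)
  ultimately show ?thesis using that S by blast
qed

section \<open>The case of two families\<close>

text \<open>The equality case is split into the existence of \<open>T\<close> and the conclusion for
  a given \<open>T\<close>, so that one \<open>T\<close> found from a single family can serve all
  pairs containing that family.\<close>

lemma cross_intersecting_pair: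
  fixes n :: nat
  defines "n \<equiv> dim (UNIV :: 'b set)"
  assumes X: "\<X> \<subseteq> k_subspaces scale k" and Y: "\<Y> \<subseteq> k_subspaces scale l"
    and ne: "\<X> \<noteq> {}" "\<Y> \<noteq> {}"
    and cross: "\<And>F G. F \<in> \<X> \<Longrightarrow> G \<in> \<Y> \<Longrightarrow> t \<le> dim (F \<inter> G)"
    and t: "1 \<le> t" "t \<le> k" "t \<le> l" and n: "n \<ge> k + l + t + 1"
  defines "a \<equiv> gauss q (n - t) (k - t)" and "b \<equiv> gauss q (n - t) (l - t)"
  shows "real (card \<X>) * real (card \<Y>) \<le> a * b"
    and "real (card \<X>) * real (card \<Y>) = a * b \<Longrightarrow> \<exists>T\<in>k_subspaces scale t. \<forall>F\<in>\<X>. T \<subseteq> F"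
    and "real (card \<X>) * real (card \<Y>) = a * b \<Longrightarrow> T \<in> k_subspaces scale t \<Longrightarrow> \<forall>F\<in>\<X>. T \<subseteq> F
      \<Longrightarrow> \<X> = {F \<in> k_subspaces scale k. T \<subseteq> F} \<and> \<Y> = {F \<in> k_subspaces scale l. T \<subseteq> F}"
proof -
  have cross': "\<And>F G. F \<in> \<Y> \<Longrightarrow> G \<in> \<X> \<Longrightarrow> t \<le> dim (F \<inter> G)"
    by (subst Int_commute) (rule cross)
  have n': "n \<ge> l + k + t + 1" using n by simp
  obtain F0 Y0 where F0: "F0 \<in> \<X>" "Y0 \<in> \<Y>" using ne by blast
  obtain s S where s: "t \<le> s" "s \<le> k" and S: "subspace S" "dim S = s"
      "\<And>G. G \<in> \<Y> \<Longrightarrow> t \<le> dim (S \<inter> G)"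
    and minS: "\<And>S'. subspace S' \<Longrightarrow> dim S' < s \<Longrightarrow> \<exists>G\<in>\<Y>. dim (S' \<inter> G) < t"
    using exists_min_cover[of F0 \<X> Y0 \<Y> k t] F0 X cross by metis
  obtain s' S' where s': "t \<le> s'" "s' \<le> l" and S': "subspace S'" "dim S' = s'"
      "\<And>G. G \<in> \<X> \<Longrightarrow> t \<le> dim (S' \<inter> G)"
    and minS': "\<And>S. subspace S \<Longrightarrow> dim S < s' \<Longrightarrow> \<exists>G\<in>\<X>. dim (S \<inter> G) < t"
    using exists_min_cover[of Y0 \<Y> F0 \<X> l t] F0 Y cross' by metis
  let ?c = "\<lambda>l. (q ^ (l - t + 1) - 1) / (q - 1)"
  have kn: "k \<le> n" "l \<le> n" using n by auto
  have bX: "real (card \<X>) \<le> gauss q s' t * (?c l ^ (s - t) * gauss q (n - s) (k - s))"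
    unfolding n_def
    by (rule card_le_cover_bound[OF X Y cross minS S']) (use s s' t kn in \<open>auto simp: n_def\<close>)
  have bY: "real (card \<Y>) \<le> gauss q s t * (?c k ^ (s' - t) * gauss q (n - s') (l - s'))"
    unfolding n_def
    by (rule card_le_cover_bound[OF Y X cross' minS' S]) (use s s' t kn in \<open>auto simp: n_def\<close>)
  have "real (card \<X>) * real (card \<Y>)
      \<le> (gauss q s' t * (?c l ^ (s - t) * gauss q (n - s) (k - s)))
        * (gauss q s t * (?c k ^ (s' - t) * gauss q (n - s') (l - s')))"
    using bX bY by (intro mult_mono) auto
  also have "\<dots> = cover_bound q n t k l s * cover_bound q n t l k s'"
    by (simp add: cover_bound_def)
  finally have bXY: "real (card \<X>) * real (card \<Y>)
      \<le> cover_bound q n t k l s * cover_bound q n t l k s'" .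
  have pos: "0 < cover_bound q n t k l s" "0 < cover_bound q n t l k s'"
    using q_gt_1 s s' kn by (auto intro: cover_bound_pos)
  have le: "cover_bound q n t k l s \<le> a" "cover_bound q n t l k s' \<le> b"
    unfolding a_def b_def using q_ge_2 t s s' n n' by (auto intro: cover_bound_le)
  have ab: "0 < a" "0 < b" unfolding a_def b_def using q_gt_1 t kn by (auto intro: gauss_pos)
  show "real (card \<X>) * real (card \<Y>) \<le> a * b"
    using bXY mult_mono[OF le] pos ab by linarith
  assume eq: "real (card \<X>) * real (card \<Y>) = a * b"
  \<comment> \<open>A strict drop in either factor would push the product below
    \<open>a * b\<close>, so equality forces both covers down to dimension \<open>t\<close>.\<close>
  have "s = t"
  proof (rule ccontr)
    assume "s \<noteq> t"
    then have "cover_bound q n t k l s < a"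
      unfolding a_def using q_ge_2 t s n by (intro cover_bound_less) auto
    then have "cover_bound q n t k l s * cover_bound q n t l k s' < a * b"
      using le(2) pos ab by (intro mult_less_le_imp_less) auto
    then show False using bXY eq by simp
  qed
  have "s' = t"
  proof (rule ccontr)
    assume "s' \<noteq> t"
    then have "cover_bound q n t l k s' < b"
      unfolding b_def using q_ge_2 t s' n' by (intro cover_bound_less) auto
    then have "cover_bound q n t k l s * cover_bound q n t l k s' < a * b"
      using le(1) pos ab by (intro mult_le_less_imp_less) auto
    then show False using bXY eq by simp
  qed
  have Xa: "real (card \<X>) \<le> a" and Yb: "real (card \<Y>) \<le> b"
    using bX bY q_gt_1 by (simp_all add: \<open>s = t\<close> \<open>s' = t\<close> a_def b_def)
  have cX: "real (card \<X>) = a"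
  proof (rule ccontr)
    assume "real (card \<X>) \<noteq> a"
    then have "real (card \<X>) * real (card \<Y>) < a * b"
      using Xa Yb ab F0 finite_families[of \<Y>]
      by (intro mult_less_le_imp_less) (auto simp: card_gt_0_iff)
    then show False using eq by simp
  qed
  have cY: "real (card \<Y>) = b" using eq cX ab by simp
  have "S' \<subseteq> F" if "F \<in> \<X>" for F
  proof -
    have F: "subspace F" using that X unfolding k_subspaces_def by auto
    have "S' \<inter> F = S'"
      using that S' F \<open>s' = t\<close> by (intro subspace_dim_equal subspace_inter) auto
    then show ?thesis by auto
  qed
  then show "\<exists>T\<in>k_subspaces scale t. \<forall>F\<in>\<X>. T \<subseteq> F"
    using S' \<open>s' = t\<close> unfolding k_subspaces_def by blast
  assume T: "T \<in> k_subspaces scale t" and TX: "\<forall>F\<in>\<X>. T \<subseteq> F"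
  have T': "subspace T" "dim T = t" using T unfolding k_subspaces_def by auto
  have full: "\<Z> = {F \<in> k_subspaces scale m. T \<subseteq> F}"
    if "\<Z> \<subseteq> k_subspaces scale m" "\<forall>F\<in>\<Z>. T \<subseteq> F" "real (card \<Z>) = gauss q (n - t) (m - t)"
      "t \<le> m" "m \<le> n" for \<Z> m
  proof (rule card_seteq)
    show "card {F \<in> k_subspaces scale m. T \<subseteq> F} \<le> card \<Z>"
      using card_star_le[OF T'(1), of m] that T' by (simp add: n_def flip: of_nat_le_iff)
  qed (use that finite_families in auto)
  have XT: "\<X> = {F \<in> k_subspaces scale k. T \<subseteq> F}"
    using X TX cX t kn by (intro full) (auto simp: a_def)
  \<comment> \<open>If some \<open>G\<close> did not contain \<open>T\<close>, the members of
    \<open>\<X>\<close>, all above \<open>T\<close>, would be spread over subspaces of dimension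
    \<open>Suc t\<close>, leaving fewer than \<open>a\<close> of them.\<close>
  have "T \<subseteq> G" if GY: "G \<in> \<Y>" for G
  proof (rule ccontr)
    assume "\<not> T \<subseteq> G"
    have G: "subspace G" "dim G = l" using GY Y unfolding k_subspaces_def by auto
    have TG: "dim (T \<inter> G) < t"
    proof (rule ccontr)
      assume "\<not> dim (T \<inter> G) < t"
      then have "T \<inter> G = T"
        using T' G by (intro subspace_dim_equal subspace_inter) auto
      then show False using \<open>\<not> T \<subseteq> G\<close> by auto
    qed
    \<comment> \<open>For \<open>k = t\<close> the inclusion \<open>T \<subseteq> F0\<close> would
      be an equality, but \<open>F0\<close> meets \<open>G\<close> in dimension at least
      \<open>t\<close> and \<open>T\<close> does not.\<close>
    have "T \<noteq> F0" using TG cross[OF F0(1) GY] by auto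
    then have "t < k"
      using F0 X TX T' t subspace_dim_equal[of T F0] unfolding k_subspaces_def by fastforce
    have "real (card {F \<in> \<X>. T \<subseteq> F}) \<le> ?c l * gauss q (n - Suc t) (k - Suc t)"
    proof (rule card_containing_step[where G = G])
      fix H' assume H': "subspace H'" "dim H' = Suc (dim T)"
      have "card {F \<in> \<X>. H' \<subseteq> F} \<le> card {F \<in> k_subspaces scale k. H' \<subseteq> F}"
        using X by (intro card_mono finite_families) auto
      then show "real (card {F \<in> \<X>. H' \<subseteq> F}) \<le> gauss q (n - Suc t) (k - Suc t)"
        using card_star_le[OF H'(1), of k] H' T' \<open>t < k\<close> kn by (simp add: n_def)
    qed (use X cross GY G T' TG t in \<open>auto simp: k_subspaces_def\<close>)
    \<comment> \<open>A factor \<open>gauss q (Suc t) t \<ge> 1\<close> is inserted so that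
      \<open>cover_bound_less\<close> applies at \<open>Suc t\<close>.\<close>
    also have "\<dots> \<le> cover_bound q n t k l (Suc t)"
    proof -
      have "1 \<le> q ^ (l - t + 1)" by (rule one_le_power) (use q_gt_1 in auto)
      then have "0 \<le> ?c l * gauss q (n - Suc t) (k - Suc t)"
        using q_gt_1 kn \<open>t < k\<close>
        by (intro mult_nonneg_nonneg divide_nonneg_nonneg less_imp_le[OF gauss_pos]) auto
      moreover have "1 \<le> gauss q (Suc t) t"
      proof -
        have "q ^ 1 \<le> q ^ Suc t" by (rule power_increasing) (use q_gt_1 in auto)
        then have "1 * (q - 1) \<le> gauss q (Suc t) t * (q - 1)"
          using gauss_Suc_left[of q t t] q_gt_1 by simp
        then show ?thesis using q_gt_1 by (simp only: mult_le_cancel_right)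
      qed
      ultimately have "1 * (?c l * gauss q (n - Suc t) (k - Suc t))
          \<le> gauss q (Suc t) t * (?c l * gauss q (n - Suc t) (k - Suc t))"
        by (intro mult_right_mono)
      then show ?thesis by (simp add: cover_bound_def mult.assoc)
    qed
    also have "\<dots> < a"
      unfolding a_def using q_ge_2 t n \<open>t < k\<close> by (intro cover_bound_less) auto
    also have "{F \<in> \<X>. T \<subseteq> F} = \<X>" using TX by auto
    finally show False using cX by simp
  qed
  then have "\<Y> = {F \<in> k_subspaces scale l. T \<subseteq> F}"
    using Y cY t kn by (intro full) (auto simp: b_def)
  with XT show "\<X> = {F \<in> k_subspaces scale k. T \<subseteq> F} \<and> \<Y> = {F \<in> k_subspaces scale l. T \<subseteq> F}"
    by blast
qed

end

section \<open>From pairs to several families\<close>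

text \<open>At most one factor exceeds 1. If none does, dropping all but \<open>x i\<close> and
  \<open>x j\<close> cannot decrease the product. If \<open>x m > 1\<close>, all others are below 1;
  pairing \<open>x m\<close> with one of them bounds the product by the rest, which is below 1
  unless it is empty.\<close>

lemma prod_le_1_if_pairwise:
  fixes x :: "'i \<Rightarrow> real"
  assumes I: "finite I" "i \<in> I" "j \<in> I" "i \<noteq> j" and pos: "\<And>a. a \<in> I \<Longrightarrow> x a > 0"
    and pair: "\<And>a b. a \<in> I \<Longrightarrow> b \<in> I \<Longrightarrow> a \<noteq> b \<Longrightarrow> x a * x b \<le> 1"
  shows "(\<Prod>a\<in>I. x a) \<le> 1 \<and> ((\<Prod>a\<in>I. x a) = 1 \<longrightarrow> x i * x j = 1)"
proof -
  have split: "(\<Prod>a\<in>I. x a) = x m * x l * (\<Prod>a\<in>I - {m} - {l}. x a)"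
    if "m \<in> I" "l \<in> I" "m \<noteq> l" for m l
    using prod.remove[OF I(1) that(1), of x] prod.remove[of "I - {m}" l x] I(1) that
    by (simp add: mult.assoc)
  show ?thesis
  proof (cases "\<forall>a\<in>I. x a \<le> 1")
    case True
    have "(\<Prod>a\<in>I - {i} - {j}. x a) \<le> 1"
      by (rule prod_le_1) (use True pos in \<open>auto intro: less_imp_le\<close>)
    moreover have "0 < x i * x j" using pos I by simp
    ultimately have "(\<Prod>a\<in>I. x a) \<le> x i * x j"
      unfolding split[OF I(2-4)] by (metis less_imp_le mult_left_le)
    then show ?thesis using pair[OF I(2-4)] by linarith
  next
    case False
    then obtain m where m: "m \<in> I" "x m > 1" by auto
    obtain l where l: "l \<in> I" "l \<noteq> m" using I by metis
    have lt: "x a < 1" if "a \<in> I" "a \<noteq> m" for a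
    proof -
      have "x a * 1 < x a * x m" using m pos that by (intro mult_strict_left_mono) auto
      then show ?thesis using pair[of a m] that m by simp
    qed
    let ?P = "\<Prod>a\<in>I - {m} - {l}. x a"
    have P: "?P \<le> 1"
      by (rule prod_le_1) (use lt pos in \<open>auto intro: less_imp_le\<close>)
    have ml: "0 < x m * x l" "x m * x l \<le> 1" using pos pair m l by auto
    have Ple: "(\<Prod>a\<in>I. x a) \<le> ?P"
      unfolding split[OF m(1) l(1) l(2)[symmetric]]
      using ml pos by (intro mult_left_le_one_le prod_nonneg) (auto intro: less_imp_le)
    show ?thesis
    proof (cases "I - {m} - {l} = {}")
      case True
      then have "(i = m \<and> j = l) \<or> (i = l \<and> j = m)" using I by auto
      then show ?thesis
        using split[OF m(1) l(1) l(2)[symmetric]] True ml(2)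
        by (auto simp: mult.commute simp del: Diff_insert)
    next
      case False
      then obtain p where p: "p \<in> I - {m} - {l}" by blast
      have "?P = x p * (\<Prod>a\<in>I - {m} - {l} - {p}. x a)"
        using p I(1) by (intro prod.remove) auto
      also have "\<dots> \<le> x p"
        using lt pos p by (intro mult_left_le prod_le_1) (auto intro: less_imp_le)
      also have "\<dots> < 1" using lt p by auto
      finally show ?thesis using Ple by simp
    qed
  qed
qed

theorem theorem1p2:
  fixes scale :: "'a::{field,finite} \<Rightarrow> 'b::ab_group_add \<Rightarrow> 'b"
    and q n r t :: nat
    and k :: "nat \<Rightarrow> nat"
    and \<F> :: "nat \<Rightarrow> 'b set set"
  assumes "vector_space scale"
    and "CARD('a) = q"
    and "vector_space.dim scale (UNIV :: 'b set) = n"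
    and "t \<ge> 1" and "r \<ge> 2"
    and "\<And>i. i \<in> {1..<r} \<Longrightarrow> k i \<ge> k (i + 1)"
    and "k r \<ge> t"
    and "n \<ge> k 1 + k 2 + t + 1"
    and "\<And>i. i \<in> {1..r} \<Longrightarrow> \<F> i \<subseteq> k_subspaces scale (k i)"
    and "cross_intersecting scale r t \<F>"
  shows "(\<Prod>i = 1..r. real (card (\<F> i)))
           \<le> (\<Prod>i = 1..r. gaussian_binomial q (int n - int t) (int (k i) - int t)) \<and>
         ((\<Prod>i = 1..r. real (card (\<F> i)))
            = (\<Prod>i = 1..r. gaussian_binomial q (int n - int t) (int (k i) - int t))
          \<longrightarrow> (\<exists>T \<in> k_subspaces scale t.
                \<forall>i \<in> {1..r}. \<F> i = {F \<in> k_subspaces scale (k i). T \<subseteq> F}))"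
proof -
  interpret vector_space scale by fact
  obtain B where B: "independent B" "UNIV \<subseteq> span B" "card B = dim (UNIV :: 'b set)"
    using basis_exists[of UNIV] by metis
  \<comment> \<open>Positive dimension makes the basis finite, since an infinite one would have
    cardinality 0.\<close>
  have "card B > 0" using B assms(3,8) by simp
  then have "finite B" by (rule card_ge_0_finite)
  interpret V: finite_field_vector_space scale B "real q"
    by unfold_locales (use B \<open>finite B\<close> assms(2) in auto)
  have antimono: "k j \<le> k i" if "1 \<le> i" "i \<le> j" "j \<le> r" for i j
    using that(2,3)
  proof (induction j rule: dec_induct)
    case (step m)
    then show ?case using assms(6)[of m] that(1) by auto
  qed simp
  have kt: "t \<le> k i" if "i \<in> {1..r}" for i
    using antimono[of i r] assms(7) that by auto
  \<comment> \<open>Of two distinct indices the smaller is at least 1 and the larger at least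
    2.\<close>
  have kk: "k i + k j \<le> k 1 + k 2" if "i \<in> {1..r}" "j \<in> {1..r}" "i \<noteq> j" for i j
  proof (cases "i < j")
    case True
    then have "k i \<le> k 1" "k j \<le> k 2" using that by (auto intro: antimono)
    then show ?thesis by simp
  next
    case False
    then have "k j \<le> k 1" "k i \<le> k 2" using that by (auto intro: antimono)
    then show ?thesis by simp
  qed
  have kn: "k i \<le> n" if "i \<in> {1..r}" for i
    using antimono[of 1 i] assms(8) that by auto
  define g where "g i = gauss (real q) (n - t) (k i - t)" for i
  have g: "gaussian_binomial q (int n - int t) (int (k i) - int t) = g i" if "i \<in> {1..r}" for i
  proof -
    have eqs: "int n - int t = int (n - t)" "int (k i) - int t = int (k i - t)"
      using kt[OF that] kn[OF that] by auto
    show ?thesis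
      unfolding g_def eqs by (rule gaussian_binomial_eq_gauss) (use kn[OF that] in simp)
  qed
  have q1: "real q > 1" by (rule V.q_gt_1)
  have gpos: "g i > 0" if "i \<in> {1..r}" for i
    unfolding g_def using q1 kn[OF that] by (intro gauss_pos) auto
  have rhs: "(\<Prod>i = 1..r. gaussian_binomial q (int n - int t) (int (k i) - int t))
      = (\<Prod>i = 1..r. g i)"
    by (rule prod.cong) (use g in auto)
  have gprod: "(\<Prod>i = 1..r. g i) > 0" by (rule prod_pos) (use gpos in auto)
  show ?thesis
  proof (cases "\<exists>i\<in>{1..r}. \<F> i = {}")
    \<comment> \<open>With an empty family the left side is 0 and the right side positive, so
      equality cannot occur.\<close>
    case True
    then obtain i where "i \<in> {1..r}" "real (card (\<F> i)) = 0" by auto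
    then have zero: "(\<Prod>i = 1..r. real (card (\<F> i))) = 0" by (intro prod_zero) blast+
    show ?thesis unfolding rhs zero using gprod by (metis order_less_le)
  next
    case False
    then have ne: "\<F> i \<noteq> {}" if "i \<in> {1..r}" for i using False that by auto
    have cross: "t \<le> dim (F \<inter> G)"
      if ij: "i \<in> {1..r}" "j \<in> {1..r}" "i \<noteq> j" and FG: "F \<in> \<F> i" "G \<in> \<F> j" for i j F G
    proof -
      \<comment> \<open>Arbitrary members of the other families complete \<open>F\<close> and
        \<open>G\<close> to a full tuple, whose intersection lies in
        \<open>F \<inter> G\<close>.\<close>
      define E where "E = (\<lambda>m. SOME X. X \<in> \<F> m)(i := F, j := G)"
      have "\<forall>m\<in>{1..r}. E m \<in> \<F> m"
        using FG ne by (auto simp: E_def some_in_eq)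
      then have "t \<le> dim (\<Inter>m\<in>{1..r}. E m)"
        using assms(10) unfolding cross_intersecting_def by blast
      moreover have "E i = F" "E j = G" using ij by (auto simp: E_def)
      then have "(\<Inter>m\<in>{1..r}. E m) \<subseteq> F \<inter> G" using ij by blast
      ultimately show ?thesis using V.dim_subset by (meson order_trans)
    qed
    have pair_n: "k i + k j + t + 1 \<le> n"
      if "i \<in> {1..r}" "j \<in> {1..r}" "i \<noteq> j" for i j
      using kk[OF that] assms(8) by simp
    have pair: "real (card (\<F> i)) * real (card (\<F> j)) \<le> g i * g j"
      "real (card (\<F> i)) * real (card (\<F> j)) = g i * g j
        \<Longrightarrow> \<exists>T\<in>k_subspaces scale t. \<forall>F\<in>\<F> i. T \<subseteq> F"
      "real (card (\<F> i)) * real (card (\<F> j)) = g i * g j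
        \<Longrightarrow> T \<in> k_subspaces scale t \<Longrightarrow> \<forall>F\<in>\<F> i. T \<subseteq> F
        \<Longrightarrow> \<F> i = {F \<in> k_subspaces scale (k i). T \<subseteq> F}
          \<and> \<F> j = {F \<in> k_subspaces scale (k j). T \<subseteq> F}"
      if ij: "i \<in> {1..r}" "j \<in> {1..r}" "i \<noteq> j" for i j T
      using V.cross_intersecting_pair[OF assms(9)[OF ij(1)] assms(9)[OF ij(2)] ne[OF ij(1)]
          ne[OF ij(2)] cross[OF ij] assms(4) kt[OF ij(1)] kt[OF ij(2)], unfolded assms(3),
          OF _ _ pair_n[OF ij]]
      unfolding g_def by blast+
    define x where "x i = real (card (\<F> i)) / g i" for i
    have xpos: "x i > 0" if "i \<in> {1..r}" for i
      unfolding x_def using gpos[OF that] ne[OF that] V.finite_families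
      by (auto simp: card_gt_0_iff)
    have xx: "x i * x j \<le> 1" if "i \<in> {1..r}" "j \<in> {1..r}" "i \<noteq> j" for i j
      using pair(1)[of i j] that gpos[of i] gpos[of j] by (simp add: x_def divide_le_eq)
    have prodx: "(\<Prod>i = 1..r. x i) = (\<Prod>i = 1..r. real (card (\<F> i))) / (\<Prod>i = 1..r. g i)"
      unfolding x_def by (rule prod_dividef)
    \<comment> \<open>The distinguished pair is \<open>1\<close> and \<open>j\<close>: equality in
      the product then makes every pair containing the first family extremal.\<close>
    have main: "(\<Prod>i = 1..r. x i) \<le> 1 \<and> ((\<Prod>i = 1..r. x i) = 1 \<longrightarrow> x 1 * x j = 1)"
      if "j \<in> {2..r}" for j
      by (rule prod_le_1_if_pairwise) (use that xpos xx in auto)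
    have "\<exists>T \<in> k_subspaces scale t. \<forall>i \<in> {1..r}. \<F> i = {F \<in> k_subspaces scale (k i). T \<subseteq> F}"
      if eq: "(\<Prod>i = 1..r. real (card (\<F> i))) = (\<Prod>i = 1..r. g i)"
    proof -
      have e: "real (card (\<F> 1)) * real (card (\<F> j)) = g 1 * g j" if "j \<in> {2..r}" for j
      proof -
        have "(\<Prod>i = 1..r. x i) = 1"
          unfolding prodx eq using gprod by (metis divide_self less_irrefl)
        then have "x 1 * x j = 1" using main[OF that] by blast
        moreover have "0 < g 1" "0 < g j" using that by (auto intro: gpos)
        ultimately show ?thesis by (simp add: x_def)
      qed
      \<comment> \<open>\<open>T\<close> is found once, from the first two families, and then reused
        for each pair \<open>1\<close>, \<open>j\<close>.\<close>
      have "\<exists>T\<in>k_subspaces scale t. \<forall>F\<in>\<F> 1. T \<subseteq> F"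
        by (rule pair(2)[of 1 2]) (use e[of 2] assms(5) in auto)
      then obtain T where T: "T \<in> k_subspaces scale t" "\<forall>F\<in>\<F> 1. T \<subseteq> F" by blast
      have stars: "\<F> 1 = {F \<in> k_subspaces scale (k 1). T \<subseteq> F} \<and>
          \<F> j = {F \<in> k_subspaces scale (k j). T \<subseteq> F}" if "j \<in> {2..r}" for j
        by (rule pair(3)[of 1 j]) (use e[OF that] that T in auto)
      have "\<F> i = {F \<in> k_subspaces scale (k i). T \<subseteq> F}" if "i \<in> {1..r}" for i
        using stars[of i] stars[of 2] assms(5) that by (cases "i = 1") auto
      then show ?thesis using T(1) by blast
    qed
    moreover have "(\<Prod>i = 1..r. real (card (\<F> i))) \<le> (\<Prod>i = 1..r. g i)"
      using main[of 2, THEN conjunct1] assms(5) gprod unfolding prodx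
      by (simp only: divide_le_eq_1_pos) auto
    ultimately show ?thesis unfolding rhs by blast
  qed
qed

end
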